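(* In the cognitive multi-hop relay model described in the context, the Original Problem is equivalent to the optimization problem consisting of the Master Problem together with the Subproblems for all pairs $0\le i<j\le M$. That is, they have the same optimal value: $$\max_{\Omega:\ \sum_{i=0}^{M-1}\sum_{j=i+1}^{M}\Pr(i,j)\overline{P}_{ij}(\Omega_{ij})\le P_0}\ \min_{m\in\{1,\dots,M\}}\sum_{i=0}^{m-1}\sum_{j=m}^{M}\Pr(i,j)\,U_{ij}(\Omega_{ij}) =\max_{\{\overline{P}_{ij}\}:\ \sum_{i=0}^{M-1}\sum_{j=i+1}^{M}\Pr(i,j)\overline{P}_{ij}\le P_0}\ \min_{m\in\{1,\dots,M\}}\sum_{i=0}^{m-1}\sum_{j=m}^{M}\Pr(i,j)\,U^*_{ij}(\overline{P}_{ij}),$$ where on the left $\Omega=\{\Omega_{ij}\}_{0\le i<j\le M}$ ranges over all collections of segment control policies (Original Problem), on the right $\{\overline{P}_{ij}\}_{0\le i<j\le M}$ ranges over collections of power budgets (Master Problem), and $U^*_{ij}(\overline{P}_{ij})$ is the optimal value of the Subproblem $$U^*_{ij}(\overline{P}_{ij})=\max_{\Omega_{ij}:\ \overline{P}_{ij}(\Omega_{ij})\le\overline{P}_{ij}}U_{ij}(\Omega_{ij}).$$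
   Context: Nodes and segments. A route consists of ordered nodes $R_0,\dots,R_M$. Each node $R_m$ has a random availability state $A_m\in\{0,1\}$, with $A_{-1}=A_{M+1}=0$. $\Pr(i,j)$ is the probability that $A_{i-1}=0$, $A_i=\dots=A_j=1$, $A_{j+1}=0$ (the event that $R_i,\dots,R_j$ form a continuous segment $L_{ij}$). $P_0>0$ is a given total power budget. Channel. The gain from node $s$ to node $t$ in frame $k$ is $G_{st}(k)=|H_{st}(k)|^2D_{st}$, where $D_{st}>0$ is a deterministic path loss and the $H_{st}(k)$ are independent zero-mean unit-variance complex Gaussian variables. System state and policy in segment $L_{ij}$. At frame $k\in\{1,\dots,j-i\}$ the state is $\eta_{ij}(k)=\{s_{ij}(k),\mathbf{G}_{s_{ij}(k)}\}$, where $s_{ij}(k)\in\{i,\dots,j\}$ is the index of the current transmitting node, $s_{ij}(1)=i$, and $\mathbf{G}_s=(G_{st}(k))_{t=s+1,\dots,j}$ is the local channel state at node $s$ in the current frame. A (stationary) control policy $\Omega_{ij}=\{\mathcal{L}_{ij},\mathcal{P}_{ij}\}$ maps $\eta_{ij}(k)$ to a next-hop index $l_{ij}(k)=\mathcal{L}_{ij}(\eta_{ij}(k))$ with $s_{ij}(k)\le l_{ij}(k)\le j$ (the left inequality strict if $s_{ij}(k)<j$) and to a power $P_{ij}(k)=\mathcal{P}_{ij}(\eta_{ij}(k))>0$. The state evolves with transition kernel $\Pr(\eta_{ij}(k+1)\mid\eta_{ij}(k),\Omega_{ij})=\mathbf{1}(s_{ij}(k+1)=l_{ij}(k))\Pr(\mathbf{G}_{s_{ij}(k+1)})$,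 i.e. $s_{ij}(k+1)=l_{ij}(k)$ and the new local channel state is drawn independently of the past. $E^{\Omega_{ij}}$ denotes expectation under the induced law. Per-frame quantities. If $s_{ij}(k)<j$, then $$T(\eta_{ij}(k),\Omega_{ij})=\frac{1}{\log(1+G_{s_{ij}(k)l_{ij}(k)}(k)P_{ij}(k))},\qquad P(\eta_{ij}(k),\Omega_{ij})=\frac{P_{ij}(k)}{\log(1+G_{s_{ij}(k)l_{ij}(k)}(k)P_{ij}(k))};$$ both are $0$ if $s_{ij}(k)=j$. Segment throughput and power: $$U_{ij}(\Omega_{ij})=E^{\Omega_{ij}}\left(\frac{1}{\sum_{k=1}^{j-i}T(\eta_{ij}(k),\Omega_{ij})}\right),\qquad \overline{P}_{ij}(\Omega_{ij})=E^{\Omega_{ij}}\left(\frac{\sum_{k=1}^{j-i}P(\eta_{ij}(k),\Omega_{ij})}{\sum_{k=1}^{j-i}T(\eta_{ij}(k),\Omega_{ij})}\right).$$ The policies $\Omega_{ij}$ for different pairs $(i,j)$ are chosen independently of each other. Maxima are understood as optimal values (suprema), and the power budgets $\overline{P}_{ij}$ in the Master Problem are positive reals. *)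

theory Defs
  imports "HOL-Probability.Probability"
begin

section \<open>Channel\<close>

text \<open>Density of the circularly symmetric law CN(0,1): real and imaginary part are independent
  with law N(0,1/2), so that the mean is 0 and the expectation of the squared modulus is 1.\<close>

definition complex_normal_density :: "complex \<Rightarrow> real" where
  "complex_normal_density z = exp (- (cmod z)\<^sup>2) / pi"

definition gain ::
    "(nat \<Rightarrow> nat \<Rightarrow> real) \<Rightarrow> (nat \<Rightarrow> nat \<Rightarrow> nat \<Rightarrow> 'a \<Rightarrow> complex) \<Rightarrow> nat \<Rightarrow> nat \<Rightarrow> nat \<Rightarrow> 'a \<Rightarrow> real" where
  "gain D H s t k \<omega> = (cmod (H s t k \<omega>))\<^sup>2 * D s t"

section \<open>Availability\<close>

text \<open>Nodes are indexed by integers here because of the boundary convention at index -1.\<close>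

definition segment_prob :: "'a measure \<Rightarrow> (int \<Rightarrow> 'a \<Rightarrow> nat) \<Rightarrow> nat \<Rightarrow> nat \<Rightarrow> real" where
  "segment_prob S A i j =
     measure S {\<omega> \<in> space S. A (int i - 1) \<omega> = 0 \<and> (\<forall>m\<in>{int i..int j}. A m \<omega> = 1) \<and> A (int j + 1) \<omega> = 0}"

section \<open>States and policies of a segment\<close>

text \<open>A state consists of the transmitting node \<open>s\<close> and the vector of gains towards
  the nodes \<open>s+1,\<dots>,j\<close>.\<close>

type_synonym state = "nat \<times> (nat \<Rightarrow> real)"

record policy =
  next_hop :: "state \<Rightarrow> nat"
  tx_power :: "state \<Rightarrow> real"

definition csi_space :: "nat \<Rightarrow> nat \<Rightarrow> (nat \<Rightarrow> real) measure" where
  "csi_space j s = (\<Pi>\<^sub>M t\<in>{s+1..j}. restrict_space borel {0..})"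

definition segment_policies :: "nat \<Rightarrow> nat \<Rightarrow> policy set" where
  "segment_policies i j = {\<Omega>. \<forall>s\<in>{i..j}.
     (\<lambda>g. next_hop \<Omega> (s, g)) \<in> csi_space j s \<rightarrow>\<^sub>M count_space UNIV \<and>
     (\<lambda>g. tx_power \<Omega> (s, g)) \<in> csi_space j s \<rightarrow>\<^sub>M borel \<and>
     (\<forall>g\<in>space (csi_space j s).
        s \<le> next_hop \<Omega> (s, g) \<and> next_hop \<Omega> (s, g) \<le> j \<and>
        (s < j \<longrightarrow> s < next_hop \<Omega> (s, g)) \<and>
        0 < tx_power \<Omega> (s, g))}"

text \<open>The restriction to \<open>{s+1..j}\<close> makes the policy depend on the local gains of the
  current frame only.\<close>

definition local_csi ::
    "(nat \<Rightarrow> nat \<Rightarrow> nat \<Rightarrow> 'a \<Rightarrow> real) \<Rightarrow> nat \<Rightarrow> nat \<Rightarrow> nat \<Rightarrow> 'a \<Rightarrow> (nat \<Rightarrow> real)" where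
  "local_csi G j s k \<omega> = (\<lambda>t\<in>{s+1..j}. G s t k \<omega>)"

text \<open>Frames are numbered from 1; the value at frame 0 is irrelevant.  The controlled chain is
  realised on the space carrying the gains: as the gains of different frames are independent,
  its transition kernel moves to the chosen next hop and draws fresh local gains there.\<close>

primrec tx_node ::
    "(nat \<Rightarrow> nat \<Rightarrow> nat \<Rightarrow> 'a \<Rightarrow> real) \<Rightarrow> nat \<Rightarrow> nat \<Rightarrow> policy \<Rightarrow> nat \<Rightarrow> 'a \<Rightarrow> nat" where
  "tx_node G i j \<Omega> 0 \<omega> = i"
| "tx_node G i j \<Omega> (Suc k) \<omega> =
     (if k = 0 then i
      else next_hop \<Omega> (tx_node G i j \<Omega> k \<omega>, local_csi G j (tx_node G i j \<Omega> k \<omega>) k \<omega>))"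

definition seg_state ::
    "(nat \<Rightarrow> nat \<Rightarrow> nat \<Rightarrow> 'a \<Rightarrow> real) \<Rightarrow> nat \<Rightarrow> nat \<Rightarrow> policy \<Rightarrow> nat \<Rightarrow> 'a \<Rightarrow> state" where
  "seg_state G i j \<Omega> k \<omega> =
     (tx_node G i j \<Omega> k \<omega>, local_csi G j (tx_node G i j \<Omega> k \<omega>) k \<omega>)"

section \<open>Throughput and power of a segment\<close>

definition frame_T :: "nat \<Rightarrow> policy \<Rightarrow> state \<Rightarrow> real" where
  "frame_T j \<Omega> \<eta> =
     (if fst \<eta> < j then 1 / ln (1 + snd \<eta> (next_hop \<Omega> \<eta>) * tx_power \<Omega> \<eta>) else 0)"

definition frame_P :: "nat \<Rightarrow> policy \<Rightarrow> state \<Rightarrow> real" where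
  "frame_P j \<Omega> \<eta> =
     (if fst \<eta> < j then tx_power \<Omega> \<eta> / ln (1 + snd \<eta> (next_hop \<Omega> \<eta>) * tx_power \<Omega> \<eta>) else 0)"

text \<open>Expectations of nonnegative variables are taken in \<open>[0,\<infinity>]\<close>: the Bochner integral would
  give a policy of infinite mean power the value 0.  Division by 0 occurs only if some gain
  vanishes, which is a null event.\<close>

definition seg_throughput ::
    "'a measure \<Rightarrow> (nat \<Rightarrow> nat \<Rightarrow> nat \<Rightarrow> 'a \<Rightarrow> real) \<Rightarrow> nat \<Rightarrow> nat \<Rightarrow> policy \<Rightarrow> ennreal" where
  "seg_throughput S G i j \<Omega> =
     (\<integral>\<^sup>+\<omega>. ennreal (1 / (\<Sum>k=1..j-i. frame_T j \<Omega> (seg_state G i j \<Omega> k \<omega>))) \<partial>S)"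

definition seg_power ::
    "'a measure \<Rightarrow> (nat \<Rightarrow> nat \<Rightarrow> nat \<Rightarrow> 'a \<Rightarrow> real) \<Rightarrow> nat \<Rightarrow> nat \<Rightarrow> policy \<Rightarrow> ennreal" where
  "seg_power S G i j \<Omega> =
     (\<integral>\<^sup>+\<omega>. ennreal ((\<Sum>k=1..j-i. frame_P j \<Omega> (seg_state G i j \<Omega> k \<omega>)) /
                    (\<Sum>k=1..j-i. frame_T j \<Omega> (seg_state G i j \<Omega> k \<omega>))) \<partial>S)"

section \<open>The optimization problems\<close>

text \<open>Objectives are \<open>[0,\<infinity>]\<close>-valued, with \<open>0 * \<infinity> = 0\<close>: a segment of probability 0
  contributes neither throughput nor power.\<close>

definition subproblem_value ::
    "'a measure \<Rightarrow> (nat \<Rightarrow> nat \<Rightarrow> nat \<Rightarrow> 'a \<Rightarrow> real) \<Rightarrow> nat \<Rightarrow> nat \<Rightarrow> real \<Rightarrow> ennreal" where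
  "subproblem_value S G i j p =
     (SUP \<Omega>\<in>{\<Omega> \<in> segment_policies i j. seg_power S G i j \<Omega> \<le> ennreal p}. seg_throughput S G i j \<Omega>)"

definition original_feasible ::
    "'a measure \<Rightarrow> (nat \<Rightarrow> nat \<Rightarrow> nat \<Rightarrow> 'a \<Rightarrow> real) \<Rightarrow> (int \<Rightarrow> 'a \<Rightarrow> nat) \<Rightarrow> nat \<Rightarrow> real
      \<Rightarrow> (nat \<Rightarrow> nat \<Rightarrow> policy) set" where
  "original_feasible S G A M P0 =
     {\<Omega>. (\<forall>i j. i < j \<and> j \<le> M \<longrightarrow> \<Omega> i j \<in> segment_policies i j) \<and>
         (\<Sum>i=0..M-1. \<Sum>j=i+1..M. ennreal (segment_prob S A i j) * seg_power S G i j (\<Omega> i j))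
           \<le> ennreal P0}"

definition original_value ::
    "'a measure \<Rightarrow> (nat \<Rightarrow> nat \<Rightarrow> nat \<Rightarrow> 'a \<Rightarrow> real) \<Rightarrow> (int \<Rightarrow> 'a \<Rightarrow> nat) \<Rightarrow> nat \<Rightarrow> real \<Rightarrow> ennreal" where
  "original_value S G A M P0 =
     (SUP \<Omega>\<in>original_feasible S G A M P0.
        MIN m\<in>{1..M}. \<Sum>i=0..m-1. \<Sum>j=m..M.
          ennreal (segment_prob S A i j) * seg_throughput S G i j (\<Omega> i j))"

definition master_feasible ::
    "'a measure \<Rightarrow> (int \<Rightarrow> 'a \<Rightarrow> nat) \<Rightarrow> nat \<Rightarrow> real \<Rightarrow> (nat \<Rightarrow> nat \<Rightarrow> real) set" where
  "master_feasible S A M P0 =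
     {Pb. (\<forall>i j. i < j \<and> j \<le> M \<longrightarrow> 0 < Pb i j) \<and>
          (\<Sum>i=0..M-1. \<Sum>j=i+1..M. segment_prob S A i j * Pb i j) \<le> P0}"

definition master_value ::
    "'a measure \<Rightarrow> (nat \<Rightarrow> nat \<Rightarrow> nat \<Rightarrow> 'a \<Rightarrow> real) \<Rightarrow> (int \<Rightarrow> 'a \<Rightarrow> nat) \<Rightarrow> nat \<Rightarrow> real \<Rightarrow> ennreal" where
  "master_value S G A M P0 =
     (SUP Pb\<in>master_feasible S A M P0.
        MIN m\<in>{1..M}. \<Sum>i=0..m-1. \<Sum>j=m..M.
          ennreal (segment_prob S A i j) * subproblem_value S G i j (Pb i j))"

end

theory Submission
  imports Defs
begin

text \<open>The Original Problem splits segment by segment once the power spent on each segment is fixed.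
  Two points need care. A collection of policies yields an admissible collection of budgets
  only if the power of every policy is strictly positive, which holds because almost surely no gain
  vanishes. Conversely, near-optimal policies exist for all budgets simultaneously, because
  every Subproblem is feasible: transmitting with constant power \<open>p\<close> has mean power at most
  \<open>p\<close>.\<close>

section \<open>Measurability of the controlled chain and of its frame quantities\<close>

lemma local_csi_measurable:
  assumes "\<And>t. t \<in> {s+1..j} \<Longrightarrow> G s t k \<in> borel_measurable S"
    and "\<And>t \<omega>. t \<in> {s+1..j} \<Longrightarrow> 0 \<le> G s t k \<omega>"
  shows "local_csi G j s k \<in> S \<rightarrow>\<^sub>M csi_space j s"
  unfolding local_csi_def csi_space_def
  using assms by (intro measurable_restrict measurable_restrict_space2) auto

lemma local_csi_in_space:
  assumes "\<And>t. t \<in> {s+1..j} \<Longrightarrow> 0 \<le> G s t k \<omega>"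
  shows "local_csi G j s k \<omega> \<in> space (csi_space j s)"
  using assms by (auto simp: local_csi_def csi_space_def space_PiM space_restrict_space)

lemma segment_policiesD:
  assumes "\<Omega> \<in> segment_policies i j" "s \<in> {i..j}"
  shows "(\<lambda>g. next_hop \<Omega> (s, g)) \<in> csi_space j s \<rightarrow>\<^sub>M count_space UNIV"
    and "(\<lambda>g. tx_power \<Omega> (s, g)) \<in> csi_space j s \<rightarrow>\<^sub>M borel"
    and "g \<in> space (csi_space j s) \<Longrightarrow> s \<le> next_hop \<Omega> (s, g)"
    and "g \<in> space (csi_space j s) \<Longrightarrow> next_hop \<Omega> (s, g) \<le> j"
    and "g \<in> space (csi_space j s) \<Longrightarrow> s < j \<Longrightarrow> s < next_hop \<Omega> (s, g)"
    and "g \<in> space (csi_space j s) \<Longrightarrow> 0 < tx_power \<Omega> (s, g)"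
  using assms unfolding segment_policies_def by blast+

text \<open>A policy is constrained only on \<open>csi_space\<close>, whose coordinates are
  nonnegative. The gains are therefore taken nonnegative at every sample point rather than almost
  surely; then the node never leaves the segment on any path.\<close>

lemma tx_node_bounds:
  assumes \<Omega>: "\<Omega> \<in> segment_policies i j" and "i \<le> j"
    and nonneg: "\<And>s t k \<omega>. s < t \<Longrightarrow> t \<le> j \<Longrightarrow> 0 \<le> G s t k \<omega>"
  shows "tx_node G i j \<Omega> k \<omega> \<in> {i..j}"
proof (induction k)
  case (Suc k)
  let ?s = "tx_node G i j \<Omega> k \<omega>"
  have "local_csi G j ?s k \<omega> \<in> space (csi_space j ?s)"
    by (rule local_csi_in_space) (use nonneg in auto)
  from segment_policiesD(3,4)[OF \<Omega> Suc this] Suc \<open>i \<le> j\<close> show ?case by auto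
qed (use \<open>i \<le> j\<close> in auto)

text \<open>The policy is evaluated at a random node and is measurable only in the gains for each
  fixed node. Freezing the node at each of its finitely many values gives measurable pieces, and
  composition with the countably valued node variable glues them together.\<close>

lemma tx_node_measurable:
  assumes \<Omega>: "\<Omega> \<in> segment_policies i j" and "i \<le> j"
    and nonneg: "\<And>s t k \<omega>. s < t \<Longrightarrow> t \<le> j \<Longrightarrow> 0 \<le> G s t k \<omega>"
    and meas: "\<And>s t k. s < t \<Longrightarrow> t \<le> j \<Longrightarrow> 1 \<le> k \<Longrightarrow> G s t k \<in> borel_measurable S"
  shows "tx_node G i j \<Omega> k \<in> S \<rightarrow>\<^sub>M count_space {i..j}"
proof (induction k)
  case 0
  then show ?case using \<open>i \<le> j\<close> by simp
next
  case (Suc k)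
  show ?case
  \<comment> \<open>Gains are measurable from frame 1 on only. The node of frame 1 is
    \<open>i\<close> by definition, so nothing from frame 0 is consulted.\<close>
  proof (cases "k = 0")
    case True
    then show ?thesis using \<open>i \<le> j\<close> by simp
  next
    case False
    have "(\<lambda>\<omega>. next_hop \<Omega> (s, local_csi G j s k \<omega>)) \<in> S \<rightarrow>\<^sub>M count_space {i..j}"
      if s: "s \<in> {i..j}" for s
    proof -
      have csi: "local_csi G j s k \<in> S \<rightarrow>\<^sub>M csi_space j s"
        by (rule local_csi_measurable) (use meas nonneg False in auto)
      have "(\<lambda>\<omega>. next_hop \<Omega> (s, local_csi G j s k \<omega>)) \<in> S \<rightarrow>\<^sub>M count_space UNIV"
        by (rule measurable_compose[OF csi segment_policiesD(1)[OF \<Omega> s]])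
      moreover have "next_hop \<Omega> (s, local_csi G j s k \<omega>) \<in> {i..j}" if "\<omega> \<in> space S" for \<omega>
        using segment_policiesD(3,4)[OF \<Omega> s measurable_space[OF csi that]] s by auto
      ultimately show ?thesis
        by (auto simp: measurable_count_space_eq2_countable intro!: measurable_sets[of _ S "count_space UNIV"])
    qed
    from measurable_compose_countable'[OF this Suc] False show ?thesis
      by (simp add: countable_finite)
  qed
qed

lemma frame_measurable:
  assumes \<Omega>: "\<Omega> \<in> segment_policies i j" and "i \<le> j" and k: "1 \<le> k"
    and nonneg: "\<And>s t k \<omega>. s < t \<Longrightarrow> t \<le> j \<Longrightarrow> 0 \<le> G s t k \<omega>"
    and meas: "\<And>s t k. s < t \<Longrightarrow> t \<le> j \<Longrightarrow> 1 \<le> k \<Longrightarrow> G s t k \<in> borel_measurable S"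
  shows "(\<lambda>\<omega>. frame_T j \<Omega> (seg_state G i j \<Omega> k \<omega>)) \<in> borel_measurable S"
    and "(\<lambda>\<omega>. frame_P j \<Omega> (seg_state G i j \<Omega> k \<omega>)) \<in> borel_measurable S"
proof -
  have *: "(\<lambda>\<omega>. frame_T j \<Omega> (s, local_csi G j s k \<omega>)) \<in> borel_measurable S \<and>
      (\<lambda>\<omega>. frame_P j \<Omega> (s, local_csi G j s k \<omega>)) \<in> borel_measurable S"
    if s: "s \<in> {i..j}" for s
  proof (cases "s < j")
    case True
    have csi: "local_csi G j s k \<in> S \<rightarrow>\<^sub>M csi_space j s"
      by (rule local_csi_measurable) (use meas nonneg k in auto)
    have pow: "(\<lambda>\<omega>. tx_power \<Omega> (s, local_csi G j s k \<omega>)) \<in> borel_measurable S"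
      by (rule measurable_compose[OF csi segment_policiesD(2)[OF \<Omega> s]])
    have hop: "(\<lambda>\<omega>. next_hop \<Omega> (s, local_csi G j s k \<omega>)) \<in> S \<rightarrow>\<^sub>M count_space UNIV"
      by (rule measurable_compose[OF csi segment_policiesD(1)[OF \<Omega> s]])
    \<comment> \<open>The gain towards the chosen hop is a coordinate with a random index, again
      handled by countable composition. This asks for every natural \<open>t\<close>; outside
      \<open>{s+1..j}\<close> the restricted vector is the constant
      \<open>undefined\<close>.\<close>
    have "(\<lambda>\<omega>. local_csi G j s k \<omega> t) \<in> borel_measurable S" for t
      by (cases "t \<in> {s+1..j}") (use meas k in \<open>auto simp: local_csi_def\<close>)
    from measurable_compose_countable[OF this hop]
    have "(\<lambda>\<omega>. local_csi G j s k \<omega> (next_hop \<Omega> (s, local_csi G j s k \<omega>))) \<in> borel_measurable S" .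
    with pow True show ?thesis by (simp add: frame_T_def frame_P_def)
  qed (simp add: frame_T_def frame_P_def)
  have node: "tx_node G i j \<Omega> k \<in> S \<rightarrow>\<^sub>M count_space {i..j}"
    by (rule tx_node_measurable[OF \<Omega> \<open>i \<le> j\<close> nonneg meas])
  show "(\<lambda>\<omega>. frame_T j \<Omega> (seg_state G i j \<Omega> k \<omega>)) \<in> borel_measurable S"
    unfolding seg_state_def
    by (rule measurable_compose_countable'[OF _ node]) (use * in \<open>auto intro: countable_finite\<close>)
  show "(\<lambda>\<omega>. frame_P j \<Omega> (seg_state G i j \<Omega> k \<omega>)) \<in> borel_measurable S"
    unfolding seg_state_def
    by (rule measurable_compose_countable'[OF _ node]) (use * in \<open>auto intro: countable_finite\<close>)
qed

section \<open>Strict positivity of the power of a segment\<close>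

text \<open>Before reaching \<open>j\<close> a policy hops strictly forward, so the gain it uses is
  a coordinate of the local vector. This gain and the power are positive, hence so is the logarithm.
  The statement is pointwise in the sample point, so the null sets are discarded only once,
  later.\<close>

lemma frame_nonneg_pos:
  assumes \<Omega>: "\<Omega> \<in> segment_policies i j" and "i \<le> j"
    and nonneg: "\<And>s t k \<omega>. s < t \<Longrightarrow> t \<le> j \<Longrightarrow> 0 \<le> G s t k \<omega>"
    and pos: "\<And>s t. s < t \<Longrightarrow> t \<le> j \<Longrightarrow> 0 < G s t k \<omega>"
  shows "0 \<le> frame_T j \<Omega> (seg_state G i j \<Omega> k \<omega>)"
    and "0 \<le> frame_P j \<Omega> (seg_state G i j \<Omega> k \<omega>)"
    and "tx_node G i j \<Omega> k \<omega> < j \<Longrightarrow> 0 < frame_T j \<Omega> (seg_state G i j \<Omega> k \<omega>)"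
    and "tx_node G i j \<Omega> k \<omega> < j \<Longrightarrow> 0 < frame_P j \<Omega> (seg_state G i j \<Omega> k \<omega>)"
proof -
  let ?s = "tx_node G i j \<Omega> k \<omega>"
  let ?g = "local_csi G j ?s k \<omega>"
  have s: "?s \<in> {i..j}"
    by (rule tx_node_bounds[OF \<Omega> \<open>i \<le> j\<close> nonneg])
  have g: "?g \<in> space (csi_space j ?s)"
    by (rule local_csi_in_space) (use nonneg in auto)
  note D = segment_policiesD[OF \<Omega> s]
  have "0 < frame_T j \<Omega> (seg_state G i j \<Omega> k \<omega>) \<and> 0 < frame_P j \<Omega> (seg_state G i j \<Omega> k \<omega>)"
    if "?s < j"
  proof -
    have "0 < ?g (next_hop \<Omega> (?s, ?g))"
      using D(4)[OF g] D(5)[OF g that] pos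
      by (simp add: local_csi_def[of G j ?s k \<omega>] restrict_def)
    then have "0 < ?g (next_hop \<Omega> (?s, ?g)) * tx_power \<Omega> (?s, ?g)"
      using D(6)[OF g] by simp
    then show ?thesis
      using that D(6)[OF g] by (simp add: frame_T_def frame_P_def seg_state_def)
  qed
  moreover have "frame_T j \<Omega> (seg_state G i j \<Omega> k \<omega>) = 0 \<and> frame_P j \<Omega> (seg_state G i j \<Omega> k \<omega>) = 0"
    if "\<not> ?s < j"
    using that by (simp add: frame_T_def frame_P_def seg_state_def)
  ultimately show "0 \<le> frame_T j \<Omega> (seg_state G i j \<Omega> k \<omega>)"
    and "0 \<le> frame_P j \<Omega> (seg_state G i j \<Omega> k \<omega>)"
    and "?s < j \<Longrightarrow> 0 < frame_T j \<Omega> (seg_state G i j \<Omega> k \<omega>)"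
    and "?s < j \<Longrightarrow> 0 < frame_P j \<Omega> (seg_state G i j \<Omega> k \<omega>)"
    by (cases "?s < j"; force)+
qed

text \<open>A vanishing integral would force the power ratio to be 0 almost surely. But the segment
  starts at \<open>i < j\<close>, so with positive gains frame 1 alone makes numerator and
  denominator positive.\<close>

lemma (in prob_space) seg_power_pos:
  assumes \<Omega>: "\<Omega> \<in> segment_policies i j" and "i < j"
    and nonneg: "\<And>s t k \<omega>. s < t \<Longrightarrow> t \<le> j \<Longrightarrow> 0 \<le> G s t k \<omega>"
    and meas: "\<And>s t k. s < t \<Longrightarrow> t \<le> j \<Longrightarrow> 1 \<le> k \<Longrightarrow> G s t k \<in> borel_measurable M"
    and pos: "\<And>s t k. s < t \<Longrightarrow> t \<le> j \<Longrightarrow> 1 \<le> k \<Longrightarrow> AE \<omega> in M. 0 < G s t k \<omega>"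
  shows "0 < seg_power M G i j \<Omega>"
proof (rule ccontr)
  let ?T = "\<lambda>k \<omega>. frame_T j \<Omega> (seg_state G i j \<Omega> k \<omega>)"
  let ?P = "\<lambda>k \<omega>. frame_P j \<Omega> (seg_state G i j \<Omega> k \<omega>)"
  let ?q = "\<lambda>\<omega>. (\<Sum>k=1..j-i. ?P k \<omega>) / (\<Sum>k=1..j-i. ?T k \<omega>)"
  have "i \<le> j" using \<open>i < j\<close> by simp
  assume "\<not> 0 < seg_power M G i j \<Omega>"
  then have "(\<integral>\<^sup>+\<omega>. ennreal (?q \<omega>) \<partial>M) = 0"
    by (simp add: seg_power_def not_gr_zero)
  moreover have "(\<lambda>\<omega>. ennreal (?q \<omega>)) \<in> borel_measurable M"
    using frame_measurable[OF \<Omega> \<open>i \<le> j\<close> _ nonneg meas]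
    by (intro measurable_compose[OF _ measurable_ennreal]
        borel_measurable_divide borel_measurable_sum) auto
  ultimately have "AE \<omega> in M. ennreal (?q \<omega>) = 0"
    by (simp add: nn_integral_0_iff_AE)
  \<comment> \<open>Only finitely many links and frames occur in a segment, so a single almost sure
    event covers them all.\<close>
  moreover have "AE \<omega> in M. \<forall>s\<in>{..j}. \<forall>t\<in>{s<..j}. \<forall>k\<in>{1..j-i}. 0 < G s t k \<omega>"
    using pos by (intro AE_finite_allI) auto
  ultimately have "AE \<omega> in M. False"
  proof eventually_elim
    case (elim \<omega>)
    have pos': "0 < G s t k \<omega>" if "s < t" "t \<le> j" "k \<in> {1..j-i}" for s t k
      using elim(2) that by simp
    have F: "0 \<le> ?T k \<omega>" "0 \<le> ?P k \<omega>"
        "tx_node G i j \<Omega> k \<omega> < j \<Longrightarrow> 0 < ?T k \<omega>" "tx_node G i j \<Omega> k \<omega> < j \<Longrightarrow> 0 < ?P k \<omega>"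
      if "k \<in> {1..j-i}" for k
      using frame_nonneg_pos[where G = G and \<omega> = \<omega> and k = k, OF \<Omega> \<open>i \<le> j\<close>] nonneg pos' that
      by blast+
    have 1: "1 \<in> {1..j-i}" using \<open>i < j\<close> by simp
    have 2: "tx_node G i j \<Omega> 1 \<omega> < j" using \<open>i < j\<close> by simp
    have "0 < (\<Sum>k=1..j-i. ?P k \<omega>)"
      using F(2) F(4)[OF 1 2] by (intro sum_pos2[OF _ 1]) auto
    moreover have "0 < (\<Sum>k=1..j-i. ?T k \<omega>)"
      using F(1) F(3)[OF 1 2] by (intro sum_pos2[OF _ 1]) auto
    ultimately have "0 < ?q \<omega>" by simp
    with elim(1) show False by (simp add: ennreal_eq_0_iff)
  qed
  then show False by simp
qed

section \<open>From budgets to policies\<close>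

text \<open>Hopping straight to \<open>j\<close> with power \<open>p\<close> shows that a Subproblem
  is feasible for every positive budget, whatever the gains are.\<close>

lemma (in prob_space) constant_power_policy:
  fixes j :: nat
  assumes "0 < p"
  defines "\<Omega> \<equiv> \<lparr>next_hop = (\<lambda>_. j), tx_power = (\<lambda>_. p)\<rparr>"
  shows "\<Omega> \<in> segment_policies i j" and "seg_power M G i j \<Omega> \<le> ennreal p"
proof -
  show "\<Omega> \<in> segment_policies i j"
    using assms by (auto simp: segment_policies_def)
  \<comment> \<open>The ratio of the two sums is thus \<open>p\<close>, or 0 where the frame times
    sum to 0 and division by zero gives 0. This is why only an inequality is obtained.\<close>
  have "(\<Sum>k\<in>K. frame_P j \<Omega> (\<eta> k)) = p * (\<Sum>k\<in>K. frame_T j \<Omega> (\<eta> k))" for K and \<eta> :: "nat \<Rightarrow> state"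
    by (auto simp: \<Omega>_def frame_P_def frame_T_def sum_distrib_left intro!: sum.cong)
  then have "seg_power M G i j \<Omega> \<le> (\<integral>\<^sup>+\<omega>. ennreal p \<partial>M)"
    unfolding seg_power_def using \<open>0 < p\<close>
    by (intro nn_integral_mono ennreal_leI) auto
  then show "seg_power M G i j \<Omega> \<le> ennreal p"
    by (simp add: emeasure_space_1)
qed

text \<open>Suprema need not be attained and may be infinite, so they are approached by sequences in
  place of an additive error. One index \<open>n\<close> serves the whole family, so that limits can
  be taken inside sums over its members.\<close>

lemma SUP_family_approximation:
  fixes u :: "'i \<Rightarrow> 'b \<Rightarrow> ennreal"
  assumes "\<And>i. i \<in> I \<Longrightarrow> F i \<noteq> {}"
  shows "\<exists>X. \<forall>i\<in>I. (\<forall>n. X n i \<in> F i) \<and> (\<lambda>n. u i (X n i)) \<longlonglongrightarrow> (SUP x\<in>F i. u i x)"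
proof -
  have "\<exists>x. (\<forall>n. x n \<in> F i) \<and> (\<lambda>n. u i (x n)) \<longlonglongrightarrow> (SUP x\<in>F i. u i x)" if i: "i \<in> I" for i
  proof -
    obtain f :: "nat \<Rightarrow> ennreal"
      where f: "incseq f" "range f \<subseteq> u i ` F i" "(SUP x\<in>F i. u i x) = (SUP n. f n)"
      using ennreal_Sup_countable_SUP[of "u i ` F i"] assms[OF i] by auto
    from f(2) have "\<forall>n. \<exists>x. x \<in> F i \<and> u i x = f n" by (metis image_iff range_subsetD)
    then obtain x where x: "\<And>n. x n \<in> F i" "\<And>n. u i (x n) = f n" by metis
    have "f \<longlonglongrightarrow> (SUP n. f n)" using f(1) by (rule LIMSEQ_SUP)
    with x f(3) show ?thesis by (intro exI[of _ x]) simp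
  qed
  then obtain x where "\<And>i. i \<in> I \<Longrightarrow> (\<forall>n. x i n \<in> F i) \<and> (\<lambda>n. u i (x i n)) \<longlonglongrightarrow> (SUP x\<in>F i. u i x)"
    by metis
  then show ?thesis by (intro exI[of _ "\<lambda>n i. x i n"]) auto
qed

lemma master_value_le_original_value:
  assumes "prob_space S" "1 \<le> M"
  shows "master_value S G A M P0 \<le> original_value S G A M P0"
  unfolding master_value_def
\<comment> \<open>It suffices to beat every \<open>y\<close> strictly below the Master objective at
  a fixed budget collection.\<close>
proof (rule SUP_least, rule dense_le)
  fix Pb y
  let ?c = "\<lambda>i j. ennreal (segment_prob S A i j)"
  let ?I = "{(i, j). i < j \<and> j \<le> M}"
  let ?F = "\<lambda>(i, j). {\<Omega> \<in> segment_policies i j. seg_power S G i j \<Omega> \<le> ennreal (Pb i j)}"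
  assume Pb: "Pb \<in> master_feasible S A M P0"
    and y: "y < (MIN m\<in>{1..M}. \<Sum>i=0..m-1. \<Sum>j=m..M. ?c i j * subproblem_value S G i j (Pb i j))"
  have "?F ij \<noteq> {}" if ij: "ij \<in> ?I" for ij
  proof -
    obtain i j where [simp]: "ij = (i, j)" by (cases ij)
    with ij Pb have "0 < Pb i j" by (simp add: master_feasible_def)
    from prob_space.constant_power_policy[OF \<open>prob_space S\<close> this, where j = j] show ?thesis
      by (simp add: set_eq_iff) blast
  qed
  from SUP_family_approximation[of ?I ?F "\<lambda>ij. seg_throughput S G (fst ij) (snd ij)", OF this]
  obtain X where X: "\<forall>ij\<in>?I. (\<forall>n. X n ij \<in> ?F ij) \<and>
      (\<lambda>n. seg_throughput S G (fst ij) (snd ij) (X n ij))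
        \<longlonglongrightarrow> (SUP \<Omega>\<in>?F ij. seg_throughput S G (fst ij) (snd ij) \<Omega>)"
    by (rule exE)
  let ?U = "\<lambda>n m. \<Sum>i=0..m-1. \<Sum>j=m..M. ?c i j * seg_throughput S G i j (X n (i, j))"
  \<comment> \<open>Multiplication by a finite constant is continuous on the extended nonnegative
    reals, also at infinity, so the limit passes through the weights even where a Subproblem value
    is infinite.\<close>
  have "(\<lambda>n. ?U n m) \<longlonglongrightarrow> (\<Sum>i=0..m-1. \<Sum>j=m..M. ?c i j * subproblem_value S G i j (Pb i j))"
    if "m \<in> {1..M}" for m
  proof (intro tendsto_sum ennreal_tendsto_cmult)
    fix i j assume "i \<in> {0..m-1}" "j \<in> {m..M}"
    with that X[rule_format, of "(i, j)"]
    show "(\<lambda>n. seg_throughput S G i j (X n (i, j))) \<longlonglongrightarrow> subproblem_value S G i j (Pb i j)"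
      by (auto simp: subproblem_value_def)
  qed simp
  moreover have "y < (\<Sum>i=0..m-1. \<Sum>j=m..M. ?c i j * subproblem_value S G i j (Pb i j))"
    if "m \<in> {1..M}" for m
    using y that by (subst (asm) Min_gr_iff) auto
  \<comment> \<open>There are finitely many cuts \<open>m\<close>, so one \<open>n\<close> exceeds
    \<open>y\<close> at all of them.\<close>
  ultimately have "\<forall>\<^sub>F n in sequentially. \<forall>m\<in>{1..M}. y < ?U n m"
    by (intro eventually_ball_finite ballI order_tendstoD(1)) auto
  then obtain n where n: "\<forall>m\<in>{1..M}. y < ?U n m"
    using eventually_happens'[OF sequentially_bot] by blast
  let ?\<Omega> = "\<lambda>i j. X n (i, j)"
  \<comment> \<open>Each approximating policy respects its own budget, so the weighted powers stay
    below the real-valued budget sum, which is then moved into the extended reals.\<close>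
  have "(\<Sum>i=0..M-1. \<Sum>j=i+1..M. ?c i j * seg_power S G i j (?\<Omega> i j))
      \<le> (\<Sum>i=0..M-1. \<Sum>j=i+1..M. ennreal (segment_prob S A i j * Pb i j))"
    using X by (intro sum_mono) (force simp: ennreal_mult' segment_prob_def intro!: mult_left_mono)
  also have "\<dots> = ennreal (\<Sum>i=0..M-1. \<Sum>j=i+1..M. segment_prob S A i j * Pb i j)"
  proof -
    have nn: "0 \<le> segment_prob S A i j * Pb i j" if "j \<in> {i+1..M}" for i j
      using Pb that by (auto simp: master_feasible_def segment_prob_def less_imp_le)
    then have "(\<Sum>j=i+1..M. ennreal (segment_prob S A i j * Pb i j))
        = ennreal (\<Sum>j=i+1..M. segment_prob S A i j * Pb i j)" for i
      by (intro sum_ennreal) auto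
    moreover have "0 \<le> (\<Sum>j=i+1..M. segment_prob S A i j * Pb i j)" for i
      using nn by (intro sum_nonneg) auto
    ultimately show ?thesis by (simp add: sum_ennreal)
  qed
  also have "\<dots> \<le> ennreal P0"
    using Pb by (intro ennreal_leI) (simp add: master_feasible_def)
  finally have "?\<Omega> \<in> original_feasible S G A M P0"
    using X by (auto simp: original_feasible_def)
  moreover have "y \<le> (MIN m\<in>{1..M}. ?U n m)"
    using n \<open>1 \<le> M\<close> by (intro Min.boundedI) (auto intro: less_imp_le)
  ultimately show "y \<le> original_value S G A M P0"
    unfolding original_value_def by (rule SUP_upper2[where i = ?\<Omega>])
qed

section \<open>From policies to budgets\<close>

text \<open>The powers actually spent serve as budgets, so each policy competes in its own
  Subproblem. The hypothesis \<open>pos\<close> makes these budgets admissible, since the Master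
  Problem asks for strictly positive ones.\<close>

lemma original_value_le_master_value:
  assumes "1 \<le> M"
    and pos: "\<And>i j \<Omega>. i < j \<Longrightarrow> j \<le> M \<Longrightarrow> \<Omega> \<in> segment_policies i j \<Longrightarrow> 0 < seg_power S G i j \<Omega>"
    and "0 \<le> P0"
  shows "original_value S G A M P0 \<le> master_value S G A M P0"
  unfolding original_value_def
proof (rule SUP_least)
  fix \<Omega>
  let ?c = "segment_prob S A"
  let ?w = "\<lambda>i j. seg_power S G i j (\<Omega> i j)"
  assume \<Omega>: "\<Omega> \<in> original_feasible S G A M P0"
  then have pol: "\<Omega> i j \<in> segment_policies i j" if "i < j" "j \<le> M" for i j
    using that by (simp add: original_feasible_def)
  have budget: "(\<Sum>i=0..M-1. \<Sum>j=i+1..M. ennreal (?c i j) * ?w i j) \<le> ennreal P0"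
    using \<Omega> by (simp add: original_feasible_def)
  \<comment> \<open>Infinite power is possible on segments of probability 0, where any budget will do.\<close>
  define Pb where "Pb i j = (if ?w i j = \<infinity> then 1 else enn2real (?w i j))" for i j
  have Pb_pos: "0 < Pb i j" if "i < j" "j \<le> M" for i j
    using pos[OF that pol[OF that]] by (auto simp: Pb_def enn2real_positive_iff top.not_eq_extremum)
  have c_nonneg: "0 \<le> ?c i j" for i j by (simp add: segment_prob_def)
  \<comment> \<open>Each weighted power is one summand of a total bounded by \<open>P0\<close>,
    hence finite; an infinite power therefore carries weight 0.\<close>
  have fin: "?w i j < \<infinity> \<or> ?c i j = 0" if "i < j" "j \<le> M" for i j
  proof -
    have "ennreal (?c i j) * ?w i j \<le> (\<Sum>j=i+1..M. ennreal (?c i j) * ?w i j)"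
      using that by (intro member_le_sum) auto
    also have "\<dots> \<le> (\<Sum>i=0..M-1. \<Sum>j=i+1..M. ennreal (?c i j) * ?w i j)"
      using that by (intro member_le_sum[of i "{0..M-1}"]) auto
    also note budget
    finally have "ennreal (?c i j) * ?w i j < \<infinity>"
      using ennreal_less_top le_less_trans unfolding infinity_ennreal_def by blast
    then show ?thesis
      using c_nonneg[of i j] by (auto simp: ennreal_mult_less_top ennreal_eq_0_iff)
  qed
  \<comment> \<open>For weight 0 both sides vanish because \<open>0 * \<infinity> = 0\<close>, so
    the substitute budget 1 leaves the total unchanged.\<close>
  have eq: "ennreal (?c i j * Pb i j) = ennreal (?c i j) * ?w i j" if "i < j" "j \<le> M" for i j
    using fin[OF that] c_nonneg by (auto simp: Pb_def ennreal_mult' ennreal_enn2real)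
  have "(\<Sum>i=0..M-1. \<Sum>j=i+1..M. ?c i j * Pb i j) \<le> P0"
  proof -
    have nn: "0 \<le> ?c i j * Pb i j" for i j
      using c_nonneg by (simp add: Pb_def)
    have "ennreal (\<Sum>i=0..M-1. \<Sum>j=i+1..M. ?c i j * Pb i j)
        = (\<Sum>i=0..M-1. \<Sum>j=i+1..M. ennreal (?c i j * Pb i j))"
      using nn by (simp add: sum_ennreal sum_nonneg)
    also have "\<dots> = (\<Sum>i=0..M-1. \<Sum>j=i+1..M. ennreal (?c i j) * ?w i j)"
      using eq by (intro sum.cong) auto
    also note budget
    finally show ?thesis by (simp only: ennreal_le_iff[OF \<open>0 \<le> P0\<close>])
  qed
  then have feas: "Pb \<in> master_feasible S A M P0"
    using Pb_pos by (simp add: master_feasible_def)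
  have term_le: "ennreal (?c i j) * seg_throughput S G i j (\<Omega> i j)
      \<le> ennreal (?c i j) * subproblem_value S G i j (Pb i j)" if "i < j" "j \<le> M" for i j
  \<comment> \<open>A policy of infinite power is not feasible for the substitute budget; that case
    is absorbed here by the zero weight.\<close>
  proof (cases "?c i j = 0")
    case False
    with fin[OF that] have "?w i j \<le> ennreal (Pb i j)"
      by (auto simp: Pb_def ennreal_enn2real)
    with pol[OF that] show ?thesis
      unfolding subproblem_value_def by (intro mult_left_mono SUP_upper) auto
  qed simp
  have "(MIN m\<in>{1..M}. \<Sum>i=0..m-1. \<Sum>j=m..M. ennreal (?c i j) * seg_throughput S G i j (\<Omega> i j))
      \<le> (MIN m\<in>{1..M}. \<Sum>i=0..m-1. \<Sum>j=m..M. ennreal (?c i j) * subproblem_value S G i j (Pb i j))"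
    (is "Min (?u ` _) \<le> Min (?v ` _)")
  proof (rule Min.boundedI)
    fix b assume "b \<in> ?v ` {1..M}"
    then obtain m where m: "m \<in> {1..M}" "b = ?v m" by blast
    then have "Min (?u ` {1..M}) \<le> ?u m" by (intro Min_le) auto
    also have "\<dots> \<le> b" unfolding m(2) using m(1) term_le by (intro sum_mono) auto
    finally show "Min (?u ` {1..M}) \<le> b" .
  qed (use \<open>1 \<le> M\<close> in auto)
  with feas show "(MIN m\<in>{1..M}. \<Sum>i=0..m-1. \<Sum>j=m..M.
      ennreal (?c i j) * seg_throughput S G i j (\<Omega> i j)) \<le> master_value S G A M P0"
    unfolding master_value_def by (rule SUP_upper2[where i = Pb])
qed

section \<open>Almost sure positivity of the gains and conclusion\<close>

text \<open>A law with a density is absolutely continuous with respect to Lebesgue measure, for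
  which single points are null.\<close>

lemma distributed_lborel_AE_neq:
  fixes X :: "'a \<Rightarrow> 'b::euclidean_space"
  assumes "distributed S lborel X f"
  shows "AE \<omega> in S. X \<omega> \<noteq> c"
proof -
  have f: "f \<in> borel_measurable lborel" and X: "X \<in> S \<rightarrow>\<^sub>M lborel"
    using assms by (auto simp: distributed_def)
  have "AE x in density lborel f. x \<noteq> c"
    using AE_lborel_singleton[of c] by (subst AE_density[OF f]) auto
  then have "AE x in distr S lborel X. x \<noteq> c"
    unfolding distributed_distr_eq_density[OF assms] .
  then show ?thesis using X by (rule AE_distrD[rotated])
qed

theorem mainTheorem2:
  fixes S :: "'a measure"
    and M :: nat
    and A :: "int \<Rightarrow> 'a \<Rightarrow> nat"
    and H :: "nat \<Rightarrow> nat \<Rightarrow> nat \<Rightarrow> 'a \<Rightarrow> complex"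
    and D :: "nat \<Rightarrow> nat \<Rightarrow> real"
    and P0 :: real
  assumes "prob_space S"
    and "M \<ge> 1"
    and "P0 > 0"
    and "\<And>m. m \<in> {0..int M} \<Longrightarrow> A m \<in> S \<rightarrow>\<^sub>M count_space UNIV"
    and "\<And>m \<omega>. m \<in> {0..int M} \<Longrightarrow> \<omega> \<in> space S \<Longrightarrow> A m \<omega> \<in> {0, 1}"
    and "\<And>\<omega>. \<omega> \<in> space S \<Longrightarrow> A (-1) \<omega> = 0"
    and "\<And>\<omega>. \<omega> \<in> space S \<Longrightarrow> A (int M + 1) \<omega> = 0"
    and "\<And>s t. s < t \<Longrightarrow> t \<le> M \<Longrightarrow> D s t > 0"
    and "\<And>s t k. s < t \<Longrightarrow> t \<le> M \<Longrightarrow> k \<ge> 1 \<Longrightarrow>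
           distributed S lborel (H s t k) (\<lambda>z. ennreal (complex_normal_density z))"
    and "prob_space.indep_vars S (\<lambda>_. borel) (\<lambda>(s, t, k). H s t k)
           {(s, t, k). s < t \<and> t \<le> M \<and> k \<ge> 1}"
  shows "original_value S (gain D H) A M P0 = master_value S (gain D H) A M P0"
proof (rule antisym)
  interpret prob_space S by fact
  have H: "H s t k \<in> borel_measurable S" if "s < t" "t \<le> M" "1 \<le> k" for s t k
    using distributed_measurable[OF assms(9)[OF that]] by simp
  show "original_value S (gain D H) A M P0 \<le> master_value S (gain D H) A M P0"
  proof (rule original_value_le_master_value)
    fix i j \<Omega>
    assume ij: "i < j" "j \<le> M" and \<Omega>: "\<Omega> \<in> segment_policies i j"
    show "0 < seg_power S (gain D H) i j \<Omega>"
    proof (rule seg_power_pos[OF \<Omega> \<open>i < j\<close>])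
      fix s t k assume st: "s < t" "t \<le> j"
      then have D: "0 < D s t" using assms(8) ij by simp
      \<comment> \<open>A squared modulus times a positive path loss is nonnegative everywhere and
        in every frame, including frame 0, so this precedes the assumption
        \<open>1 \<le> k\<close>.\<close>
      show "0 \<le> gain D H s t k \<omega>" for \<omega> using D by (simp add: gain_def)
      assume k: "1 \<le> k"
      have [measurable]: "H s t k \<in> borel_measurable S" using H st ij k by simp
      show "gain D H s t k \<in> borel_measurable S"
        unfolding gain_def[abs_def] by measurable
      \<comment> \<open>The gain vanishes only where the fading coefficient does, and that is a null
        event.\<close>
      have "AE \<omega> in S. H s t k \<omega> \<noteq> 0"
        using distributed_lborel_AE_neq[OF assms(9)] st ij k by simp
      then show "AE \<omega> in S. 0 < gain D H s t k \<omega>"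
        by eventually_elim (use D in \<open>simp add: gain_def\<close>)
    qed
  qed (use assms in auto)
  show "master_value S (gain D H) A M P0 \<le> original_value S (gain D H) A M P0"
    using assms by (intro master_value_le_original_value) auto
qed

end
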